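(* Let $A$ be an $m\times n$ integer matrix with $\operatorname{rank}A=m<n$, let $L=\ker A\subset\mathbb{R}^n$ and let $\Lambda=\mathbb{Z}^n\cap L$. Suppose that $\|A\|_{\mathrm{op}}\le\gamma$ for some $\gamma\ge1$. For $s>0$ and $t>0$, let $B=B_{s,t}$ be the $n\times n$ positive definite matrix with eigenvectors in $L\cup L^{\perp}$ such that the eigenvectors in $L$ have eigenvalue $s$ while the eigenvectors in $L^\perp$ have eigenvalue $s+t$. Then $$\left|\Theta(B)-\Theta_\Lambda(s)\right|\ \le\ \exp\left\{-\frac{t}{\gamma^2}+\frac{2ne^{-s}}{1-e^{-s}}\right\}.$$
   Context: $\Theta(B)=\sum_{x\in\mathbb{Z}^n}e^{-\langle Bx,x\rangle}$ and $\Theta_\Lambda(s)=\sum_{x\in\Lambda}e^{-s\|x\|^2}$, where $\langle\cdot,\cdot\rangle$ and $\|\cdot\|$ are the standard scalar product and Euclidean norm in $\mathbb{R}^n$. $\|A\|_{\mathrm{op}}$ is the operator norm of $A$, that is, its largest singular value. $L^\perp$ is the orthogonal complement of $L$. *)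

theory Defs
  imports "HOL-Analysis.Analysis"
begin

definition integer_points :: "(real^'n) set" where
  "integer_points = {x. \<forall>i. x $ i \<in> \<int>}"

definition mat_kernel :: "real^'n^'m \<Rightarrow> (real^'n) set" where
  "mat_kernel A = {x. A *v x = 0}"

definition positive_definite :: "real^'n^'n \<Rightarrow> bool" where
  "positive_definite B \<longleftrightarrow> transpose B = B \<and> (\<forall>x. x \<noteq> 0 \<longrightarrow> 0 < (B *v x) \<bullet> x)"

(* For positive definite B, and for s > 0 with Lat a set of integer points, the
   series below converge; elsewhere infsum may return its default value 0. *)
definition Theta :: "real^'n^'n \<Rightarrow> real" where
  "Theta B = (\<Sum>\<^sub>\<infinity>x\<in>integer_points. exp (- ((B *v x) \<bullet> x)))"

definition Theta_lattice :: "(real^'n) set \<Rightarrow> real \<Rightarrow> real" where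
  "Theta_lattice Lat s = (\<Sum>\<^sub>\<infinity>x\<in>Lat. exp (- s * (norm x)\<^sup>2))"

(* The matrix B_{s,t} of a subspace L: L and its orthogonal complement are
   eigenspaces, with eigenvalues s and s + t.  As they span the space, this
   determines B (see eigen_split_ex1). *)
definition eigen_split :: "(real^'n) set \<Rightarrow> real \<Rightarrow> real \<Rightarrow> real^'n^'n \<Rightarrow> bool" where
  "eigen_split L s t B \<longleftrightarrow>
     positive_definite B \<and>
     (\<forall>v\<in>L. B *v v = s *\<^sub>R v) \<and>
     (\<forall>v\<in>orthogonal_comp L. B *v v = (s + t) *\<^sub>R v)"

lemma subspace_mat_kernel: "subspace (mat_kernel A)"
  unfolding mat_kernel_def subspace_def
  by (simp add: matrix_vector_right_distrib matrix_vector_mult_scaleR)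

lemma eigen_split_ex1:
  fixes L :: "(real^'n) set"
  assumes L: "subspace L" and s: "s > 0" and t: "t > 0"
  shows "\<exists>!B. eigen_split L s t B"
proof (rule ex_ex1I)
  obtain U where U: "U \<subseteq> orthogonal_comp L" "pairwise orthogonal U"
    "\<And>x. x \<in> U \<Longrightarrow> norm x = 1" "independent U" "span U = orthogonal_comp L"
    using orthonormal_basis_subspace[OF subspace_orthogonal_comp[of L]] by metis
  have fin: "finite U" using U(4) independent_imp_finite by blast
  define q where "q x = (\<Sum>u\<in>U. (u \<bullet> x) *\<^sub>R u)" for x
  define f where "f x = s *\<^sub>R x + t *\<^sub>R q x" for x
  have "linear q"
    by (rule linearI)
       (simp_all add: q_def inner_add_right scaleR_add_left sum.distrib scaleR_right.sum)
  then have lf: "linear f" unfolding f_def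
    by (intro linear_compose_add linear_compose_scale_right linear_id[unfolded id_def])
  have B: "matrix f *v x = f x" for x using lf by (simp add: matrix_works)
  have fx: "f x \<bullet> y = s * (x \<bullet> y) + t * (\<Sum>u\<in>U. (u \<bullet> x) * (u \<bullet> y))" for x y
    by (simp add: f_def q_def inner_add_left inner_sum_left)
  have sym: "transpose (matrix f) = matrix f"
  proof (rule iffD2[OF matrix_eq], rule allI)
    fix x
    have "(transpose (matrix f) *v x) \<bullet> y = (matrix f *v x) \<bullet> y" for y
      by (metis (no_types, lifting) B dot_lmul_matrix fx inner_commute
          matrix_transpose_mul mult.commute sum.cong transpose_matrix_vector)
    then show "transpose (matrix f) *v x = matrix f *v x"
      by (metis vector_eq_rdot)
  qed
  have pos: "0 < (matrix f *v x) \<bullet> x" if "x \<noteq> 0" for x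
  proof -
    have "0 \<le> (\<Sum>u\<in>U. (u \<bullet> x) * (u \<bullet> x))" by (simp add: sum_nonneg)
    moreover have "0 < s * (x \<bullet> x)" using s that by simp
    ultimately show ?thesis unfolding B fx using t by (simp add: add_pos_nonneg)
  qed
  have onL: "f v = s *\<^sub>R v" if "v \<in> L" for v
  proof -
    have "u \<bullet> v = 0" if "u \<in> U" for u
      using that \<open>v \<in> L\<close> U(1)
      by (auto simp: orthogonal_comp_def orthogonal_def inner_commute)
    then show ?thesis by (simp add: f_def q_def)
  qed
  have onLp: "f v = (s + t) *\<^sub>R v" if "v \<in> orthogonal_comp L" for v
  proof -
    have "(\<Sum>u\<in>U. (v \<bullet> u) *\<^sub>R u) = v"
      using U fin that
      by (intro orthonormal_basis_expand) (auto simp: pairwise_def)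
    then have "q v = v" by (simp add: q_def inner_commute)
    then show ?thesis by (simp add: f_def scaleR_add_left)
  qed
  show "\<exists>B. eigen_split L s t B"
    using sym pos onL onLp B
    unfolding eigen_split_def positive_definite_def by (intro exI[of _ "matrix f"]) auto
next
  fix B C assume BC: "eigen_split L s t B" "eigen_split L s t C"
  have "B *v x = C *v x" for x
  proof -
    have "x \<in> L + orthogonal_comp L"
      using subspace_sum_orthogonal_comp[OF L] by simp
    then obtain y z where "x = y + z" "y \<in> L" "z \<in> orthogonal_comp L"
      by (auto elim: set_plus_elim)
    then show ?thesis
      using BC by (simp add: eigen_split_def matrix_vector_right_distrib)
  qed
  then show "B = C" by (simp add: matrix_eq)
qed

end

theory Submission
  imports Defs
begin

text \<open>
  On the lattice \<open>\<Lambda>\<close> the quadratic form of \<open>B\<close> is \<open>s \<bar>x\<bar>\<^sup>2\<close>, so the difference of the two theta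
  series is the part of \<open>Theta B\<close> that runs over the integer points outside \<open>L\<close>. Such a point
  stays away from \<open>L\<close>: \<open>A x\<close> is a nonzero integer vector, hence has norm at least \<open>1\<close>, and \<open>A\<close>
  sees only the component \<open>z\<close> of \<open>x\<close> orthogonal to its kernel, so \<open>1 \<le> \<gamma> \<bar>z\<bar>\<close>. The extra
  \<open>t\<close> in the eigenvalue on the orthogonal complement therefore costs at least \<open>t / \<gamma>\<^sup>2\<close> in the exponent
  (lemmas \<open>eigen_split_inner\<close> and \<open>mat_kernel_gap\<close>).

  The difference is thus at most \<open>exp (- (t / \<gamma>\<^sup>2))\<close> times the theta series of the integer points at \<open>s\<close>. That
  series factors over the coordinates, and \<open>k\<^sup>2 \<ge> \<bar>k\<bar>\<close> for integers \<open>k\<close> compares each factor with a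
  two-sided geometric series of ratio \<open>q = exp (- s)\<close>. Its value \<open>1 + 2 q / (1 - q)\<close> is at most
  \<open>exp (2 q / (1 - q))\<close>, which gives the second term of the exponent.
\<close>

section \<open>Theta series of the integer points\<close>

lemma has_sum_exp_abs_Ints:
  fixes s :: real
  assumes "s > 0"
  shows "((\<lambda>x. exp (- s * \<bar>x\<bar>)) has_sum (1 + 2 * exp (- s) / (1 - exp (- s)))) (\<int> :: real set)"
proof -
  define g where "g x = exp (- s * \<bar>x\<bar>)" for x :: real
  define P where "P = real ` {1..}"
  define N where "N = (\<lambda>n. - real n) ` {1..}"
  have geom: "((\<lambda>n. exp (- s) ^ n) has_sum (exp (- s) / (1 - exp (- s)))) {1..}"
    using has_sum_geometric_from_1[of "exp (- s)"] assms by simp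
  have P: "(g has_sum (exp (- s) / (1 - exp (- s)))) P"
    unfolding P_def using geom
    by (subst has_sum_reindex) (auto simp: inj_on_def g_def o_def exp_of_nat_mult[symmetric] mult.commute)
  have N: "(g has_sum (exp (- s) / (1 - exp (- s)))) N"
    unfolding N_def using geom
    by (subst has_sum_reindex) (auto simp: inj_on_def g_def o_def exp_of_nat_mult[symmetric] mult.commute)
  have PN: "P \<inter> N = {}" "0 \<notin> P \<union> N"
    by (auto simp: P_def N_def)
  have "(g has_sum (g 0 + (exp (- s) / (1 - exp (- s)) + exp (- s) / (1 - exp (- s)))))
          ({0} \<union> (P \<union> N))"
    using PN by (intro has_sum_Un_disjoint P N has_sum_finiteI) auto
  moreover have "{0} \<union> (P \<union> N) = \<int>"
  proof
    show "{0} \<union> (P \<union> N) \<subseteq> \<int>"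
      by (auto simp: P_def N_def)
  next
    show "\<int> \<subseteq> {0} \<union> (P \<union> N)"
    proof
      fix x :: real assume "x \<in> \<int>"
      then obtain k where k: "x = of_int k" by (elim Ints_cases)
      consider "k = 0" | "k > 0" | "k < 0" by linarith
      then show "x \<in> {0} \<union> (P \<union> N)"
      proof cases
        case 2
        then have "x = real (nat k)" "nat k \<ge> 1" using k by auto
        then show ?thesis unfolding P_def by blast
      next
        case 3
        then have "x = - real (nat (- k))" "nat (- k) \<ge> 1" using k by auto
        then show ?thesis unfolding N_def by blast
      qed (use k in simp)
    qed
  qed
  ultimately show ?thesis
    by (simp add: g_def [abs_def])
qed

lemma sum_gaussian_Ints_le:
  fixes s :: real
  assumes s: "s > 0" and F: "finite F" "F \<subseteq> \<int>"
  shows "(\<Sum>x\<in>F. exp (- s * x\<^sup>2)) \<le> exp (2 * exp (- s) / (1 - exp (- s)))"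
proof -
  have "(\<Sum>x\<in>F. exp (- s * x\<^sup>2)) \<le> (\<Sum>x\<in>F. exp (- s * \<bar>x\<bar>))"
  proof (rule sum_mono)
    fix x assume "x \<in> F"
    then have "x \<in> \<int>" using F by auto
    then have "x = 0 \<or> 1 \<le> \<bar>x\<bar>"
      using Ints_nonzero_abs_ge1 by blast
    then have "\<bar>x\<bar> \<le> x\<^sup>2"
      using mult_right_mono[of 1 "\<bar>x\<bar>" "\<bar>x\<bar>"] by (auto simp: power2_eq_square)
    then show "exp (- s * x\<^sup>2) \<le> exp (- s * \<bar>x\<bar>)"
      using s by simp
  qed
  also have "\<dots> \<le> 1 + 2 * exp (- s) / (1 - exp (- s))"
    using F by (intro finite_sum_le_has_sum[OF has_sum_exp_abs_Ints[OF s]]) auto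
  also have "\<dots> \<le> exp (2 * exp (- s) / (1 - exp (- s)))"
    by (rule exp_ge_add_one_self)
  finally show ?thesis .
qed

text \<open>
  A finite set of integer points lies in the box spanned by its coordinate projections, and over a
  box the sum of \<open>exp (- s \<bar>x\<bar>\<^sup>2)\<close> is the product of the coordinate sums. Bounding all finite
  sums in this way yields convergence and the bound for the series at the same time.
\<close>

lemma sum_gaussian_integer_points_le:
  fixes F :: "(real^'n) set" and s :: real
  assumes s: "s > 0" and F: "finite F" "F \<subseteq> integer_points"
  shows "(\<Sum>x\<in>F. exp (- s * (norm x)\<^sup>2))
           \<le> exp (2 * real CARD('n) * exp (- s) / (1 - exp (- s)))"
proof -
  define C where "C i = (\<lambda>x. x $ i) ` F" for i
  have C: "finite (C i)" "C i \<subseteq> \<int>" for i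
    using F by (auto simp: C_def integer_points_def)
  have split: "exp (- s * (norm x)\<^sup>2) = (\<Prod>i\<in>UNIV. exp (- s * (x $ i)\<^sup>2))" for x :: "real^'n"
  proof -
    have "- s * (norm x)\<^sup>2 = (\<Sum>i\<in>UNIV. - s * (x $ i)\<^sup>2)"
      unfolding power2_norm_eq_inner inner_vec_def sum_distrib_left by (simp add: power2_eq_square)
    then show ?thesis by (simp only: exp_sum[OF finite])
  qed
  have "(\<Sum>x\<in>F. exp (- s * (norm x)\<^sup>2))
          = (\<Sum>g\<in>($) ` F. \<Prod>i\<in>UNIV. exp (- s * (g i)\<^sup>2))"
    unfolding split by (subst sum.reindex) (auto simp: inj_on_def vec_nth_inject)
  also have "\<dots> \<le> (\<Sum>g\<in>PiE UNIV C. \<Prod>i\<in>UNIV. exp (- s * (g i)\<^sup>2))"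
    using C by (intro sum_mono2 finite_PiE) (auto simp: C_def intro!: prod_nonneg)
  also have "\<dots> = (\<Prod>i\<in>UNIV. \<Sum>k\<in>C i. exp (- s * k\<^sup>2))"
    using C by (intro prod_sum_PiE [symmetric]) auto
  also have "\<dots> \<le> (\<Prod>i\<in>(UNIV :: 'n set). exp (2 * exp (- s) / (1 - exp (- s))))"
    using C s by (intro prod_mono conjI sum_nonneg sum_gaussian_Ints_le) auto
  also have "\<dots> = exp (2 * real CARD('n) * exp (- s) / (1 - exp (- s)))"
    by (simp add: exp_of_nat_mult[symmetric] mult_ac)
  finally show ?thesis .
qed

lemma
  fixes s :: real
  assumes s: "s > 0"
  shows summable_gaussian_integer_points:
      "(\<lambda>x. exp (- s * (norm x)\<^sup>2)) summable_on (integer_points :: (real^'n) set)"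
    and Theta_lattice_integer_points_le:
      "Theta_lattice (integer_points :: (real^'n) set) s
         \<le> exp (2 * real CARD('n) * exp (- s) / (1 - exp (- s)))"
proof -
  show summable: "(\<lambda>x. exp (- s * (norm x)\<^sup>2)) summable_on (integer_points :: (real^'n) set)"
  proof (rule nonneg_bdd_above_summable_on)
    show "bdd_above (sum (\<lambda>x. exp (- s * (norm x)\<^sup>2))
            ` {F. F \<subseteq> (integer_points :: (real^'n) set) \<and> finite F})"
      by (rule bdd_aboveI2) (use sum_gaussian_integer_points_le[OF s] in blast)
  qed simp
  show "Theta_lattice (integer_points :: (real^'n) set) s
         \<le> exp (2 * real CARD('n) * exp (- s) / (1 - exp (- s)))"
    unfolding Theta_lattice_def
    using summable sum_gaussian_integer_points_le[OF s] by (rule infsum_le_finite_sums)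
qed

section \<open>The quadratic form away from the kernel\<close>

text \<open>
  The cross terms vanish by orthogonality. When \<open>L\<close> is a subspace every vector has the form
  \<open>y + z\<close>, and the form of \<open>B\<close> exceeds \<open>s \<bar>x\<bar>\<^sup>2\<close> by \<open>t\<close> times the squared distance of \<open>x\<close> from \<open>L\<close>.
\<close>

lemma eigen_split_inner:
  fixes B :: "real^'n^'n"
  assumes B: "eigen_split L s t B" and y: "y \<in> L" and z: "z \<in> orthogonal_comp L"
  shows "(B *v (y + z)) \<bullet> (y + z) = s * (norm (y + z))\<^sup>2 + t * (norm z)\<^sup>2"
proof -
  have "y \<bullet> z = 0" "z \<bullet> y = 0"
    using y z by (auto simp: orthogonal_comp_def orthogonal_def inner_commute)
  moreover have "B *v (y + z) = s *\<^sub>R y + (s + t) *\<^sub>R z"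
    using B y z by (simp add: eigen_split_def matrix_vector_right_distrib)
  ultimately show ?thesis
    by (simp add: power2_norm_eq_inner inner_add_left inner_add_right algebra_simps)
qed

lemma integer_matrix_vector:
  assumes "\<forall>i j. A $ i $ j \<in> \<int>" and "x \<in> integer_points"
  shows "A *v x \<in> integer_points"
  using assms by (auto simp: integer_points_def matrix_vector_mult_def intro!: Ints_sum Ints_mult)

lemma norm_integer_point_ge_1:
  assumes "x \<in> integer_points" and "x \<noteq> 0"
  shows "1 \<le> norm x"
proof -
  obtain i where "x $ i \<noteq> 0" using assms(2) by (auto simp: vec_eq_iff)
  then have "1 \<le> \<bar>x $ i\<bar>"
    using assms(1) by (intro Ints_nonzero_abs_ge1) (auto simp: integer_points_def)
  also have "\<dots> \<le> norm x" by (rule component_le_norm_cart)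
  finally show ?thesis .
qed

text \<open>
  Integrality gives \<open>1 \<le> \<bar>A (y + z)\<bar>\<close>, and \<open>A (y + z) = A z\<close> has norm at most \<open>\<gamma> \<bar>z\<bar>\<close>. For
  \<open>z\<close> orthogonal to the kernel this bounds the distance of \<open>y + z\<close> from the kernel from below.
\<close>

lemma mat_kernel_gap:
  fixes A :: "real^'n^'m"
  assumes A: "\<forall>i j. A $ i $ j \<in> \<int>" and \<gamma>: "onorm ((*v) A) \<le> \<gamma>" "\<gamma> > 0"
    and y: "y \<in> mat_kernel A" and x: "y + z \<in> integer_points" "y + z \<notin> mat_kernel A"
  shows "1 / \<gamma>\<^sup>2 \<le> (norm z)\<^sup>2"
proof -
  have "1 \<le> norm (A *v (y + z))"
    using x by (intro norm_integer_point_ge_1 integer_matrix_vector A) (auto simp: mat_kernel_def)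
  also have "A *v (y + z) = A *v z"
    using y by (simp add: mat_kernel_def matrix_vector_right_distrib)
  also have "norm (A *v z) \<le> onorm ((*v) A) * norm z"
    by (rule onorm) simp
  also have "\<dots> \<le> \<gamma> * norm z"
    using \<gamma>(1) by (simp add: mult_right_mono)
  finally have "1 / \<gamma> \<le> norm z"
    using \<gamma>(2) by (simp add: field_simps)
  then have "(1 / \<gamma>)\<^sup>2 \<le> (norm z)\<^sup>2"
    using \<gamma>(2) by (intro power_mono) auto
  then show ?thesis by (simp add: power_divide)
qed

section \<open>Comparison of the two theta series\<close>

theorem theorem5p1:
  fixes A :: "real^'n^'m" and B :: "real^'n^'n"
    and L \<Lambda> :: "(real^'n) set" and \<gamma> s t :: real
  assumes integer_A: "\<forall>i j. A $ i $ j \<in> \<int>"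
    and rank_A: "rank A = CARD('m)" "CARD('m) < CARD('n)"
    and L: "L = mat_kernel A"
    and \<Lambda>: "\<Lambda> = integer_points \<inter> L"
    and \<gamma>: "\<gamma> \<ge> 1" "onorm ((*v) A) \<le> \<gamma>"
    and s: "s > 0" and t: "t > 0"
    and B: "eigen_split L s t B"
  shows "\<bar>Theta B - Theta_lattice \<Lambda> s\<bar>
         \<le> exp (- (t / \<gamma>\<^sup>2) + 2 * real CARD('n) * exp (- s) / (1 - exp (- s)))"
proof -
  define f where "f x = exp (- ((B *v x) \<bullet> x))" for x
  define g where "g x = exp (- s * (norm x)\<^sup>2)" for x :: "real^'n"
  define M where "M = integer_points - L"
  have "subspace L" unfolding L by (rule subspace_mat_kernel)
  have on_\<Lambda>: "f x = g x" if "x \<in> \<Lambda>" for x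
    using eigen_split_inner[OF B, of x 0] that
    by (simp add: f_def g_def \<Lambda> orthogonal_comp_def orthogonal_def)
  have on_M: "f x \<le> exp (- (t / \<gamma>\<^sup>2)) * g x" if "x \<in> M" for x
  proof -
    have "x \<in> L + orthogonal_comp L"
      using subspace_sum_orthogonal_comp[OF \<open>subspace L\<close>] by simp
    then obtain y z where x: "x = y + z" and yz: "y \<in> L" "z \<in> orthogonal_comp L"
      by (auto elim: set_plus_elim)
    have "1 / \<gamma>\<^sup>2 \<le> (norm z)\<^sup>2"
      using that \<gamma> yz(1) by (intro mat_kernel_gap[OF integer_A]) (auto simp: M_def L x)
    then have "t * (1 / \<gamma>\<^sup>2) \<le> t * (norm z)\<^sup>2"
      using t by (intro mult_left_mono) auto
    then show ?thesis
      using eigen_split_inner[OF B yz] by (simp add: f_def g_def x flip: exp_add)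
  qed
  have g: "g summable_on integer_points"
    unfolding g_def by (rule summable_gaussian_integer_points[OF s])
  have gM: "g summable_on M"
    using g by (rule summable_on_subset) (auto simp: M_def)
  have g\<Lambda>: "g summable_on \<Lambda>"
    using g by (rule summable_on_subset) (auto simp: \<Lambda>)
  have f\<Lambda>: "f summable_on \<Lambda>"
    using g\<Lambda> on_\<Lambda> by (simp cong: summable_on_cong)
  have fM: "f summable_on M"
    using summable_on_cmult_right[OF gM] on_M
    by (rule summable_on_comparison_test) (simp_all add: f_def)
  have "0 \<le> infsum f M"
    by (rule infsum_nonneg) (simp add: f_def)
  have "Theta B = infsum f (\<Lambda> \<union> M)"
    unfolding Theta_def f_def by (rule infsum_cong_neutral) (auto simp: \<Lambda> M_def)
  also have "\<dots> = infsum f \<Lambda> + infsum f M"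
    using f\<Lambda> fM by (rule infsum_Un_disjoint) (auto simp: \<Lambda> M_def)
  also have "infsum f \<Lambda> = Theta_lattice \<Lambda> s"
    unfolding Theta_lattice_def using on_\<Lambda> by (intro infsum_cong) (simp add: g_def)
  finally have "\<bar>Theta B - Theta_lattice \<Lambda> s\<bar> = infsum f M"
    using \<open>0 \<le> infsum f M\<close> by simp
  also have "\<dots> \<le> (\<Sum>\<^sub>\<infinity>x\<in>M. exp (- (t / \<gamma>\<^sup>2)) * g x)"
    using fM summable_on_cmult_right[OF gM] on_M by (rule infsum_mono)
  also have "\<dots> = exp (- (t / \<gamma>\<^sup>2)) * infsum g M"
    by (rule infsum_cmult_right')
  also have "\<dots> \<le> exp (- (t / \<gamma>\<^sup>2)) * exp (2 * real CARD('n) * exp (- s) / (1 - exp (- s)))"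
  proof (rule mult_left_mono)
    have "infsum g M \<le> infsum g integer_points"
      using gM g by (rule infsum_mono2) (auto simp: M_def g_def)
    also have "\<dots> = Theta_lattice (integer_points :: (real^'n) set) s"
      unfolding Theta_lattice_def g_def ..
    also have "\<dots> \<le> exp (2 * real CARD('n) * exp (- s) / (1 - exp (- s)))"
      by (rule Theta_lattice_integer_points_le[OF s])
    finally show "infsum g M \<le> exp (2 * real CARD('n) * exp (- s) / (1 - exp (- s)))" .
  qed simp
  finally show ?thesis
    by (simp only: exp_add)
qed

end
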